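(* Let $n\ge 2$, let $\lambda=(\lambda_1,\dots,\lambda_n)\in\mathbb{R}^n$ satisfy $1>\lambda_1>\lambda_2>\cdots>\lambda_n$ and $\lambda_1>\max_{2\le \ell\le n}|\lambda_\ell|$, and let $\beta=(\beta_1,\dots,\beta_n)\in\mathbb{R}^n$ satisfy $\sum_{\ell=1}^n\beta_\ell=1$ and $\prod_{\ell=1}^n\beta_\ell\ne 0$. For every entrywise nonnegative $A\in\mathbb{R}^{n\times n}$ with $A\mathbf{1}^\top\le\mathbf{1}^\top$, any optimal solution $P_{\sf sln}(A)$ of the problem $$(\mathbf{OP}[A]):\quad \min_{P\in\mathbb{R}^{n\times n}}\|PA-\mathrm{diag}(\lambda)P\|_F^2\quad\text{subject to}\quad P\mathbf{1}^\top=\mathbf{1}^\top,\ \ \beta P\ge\mathbf{0}$$ satisfies $\|P_{\sf sln}(A)\|\le\rho$, where $$\rho=2^{n(n-2)}\left(\frac{\sum_{i=1}^n\gamma_i^{(n-1)}}{\sum_{1\le i<j\le n}\gamma_i^{(n-1)}\gamma_j^{(n-1)}(\lambda_{[n+i-1]_n}-\lambda_{[n+j-1]_n})^2}\right)^n\big(\|\beta\|^2+4\big)^{n^2-1}(n^2-1)!\,(n+\lambda_1+\|\beta\|)\max\{\sqrt{\bar\rho},1\}$$ (which does not depend on $A$), with $\bar\rho$, $\gamma_i^{(n-1)}$, $[\cdot]_n$ and $\|\cdot\|$ as defined in the context.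
   Context: Vectors are row vectors; $\mathbf{1}$ is the all-ones vector, $\mathbf{0}$ the zero vector; vector inequalities are componentwise; $\|\cdot\|_F$ is the Frobenius norm; $\mathrm{diag}(\lambda)$ is the diagonal matrix with diagonal entries $\lambda_1,\dots,\lambda_n$. The norm $\|\cdot\|$ without subscript is the max norm: $\|a\|=\max_i|a_i|$ for $a\in\mathbb{R}^n$ and $\|M\|=\max_{i,j}|m_{ij}|$ for a matrix $M=(m_{ij})$. Put $\eta=\max\{|\beta_\ell|/|\beta_i| : 1\le i\le\ell\le n\}$ and $$\bar\rho=(n+\lambda_1)^2\Big(\tfrac{(n-1)n(2n-1)}{3}\eta^2+n(n-1)\eta+n\Big).$$ For a positive integer $\ell$, $[\ell]_n\in\{1,\dots,n\}$ is the representative of $\ell$ modulo $n$ ($[\ell]_n=n$ if $n\mid\ell$). The numbers $\gamma_i^{(k)}$ ($1\le i\le n$, $1\le k\le n-1$) are defined by $\gamma_i^{(1)}=\beta_i^2$ and $$\gamma_i^{(k+1)}=\frac{\gamma_i^{(k)}\,\gamma_{[i+1]_n}^{(k)}\,(\lambda_i-\lambda_{[i+k]_n})^2}{\gamma_i^{(k)}+\gamma_{[i+1]_n}^{(k)}},\quad 1\le i\le n,\ 1\le k\le n-2;$$ all of them are positive. *)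

theory Defs
  imports Complex_Main "Jordan_Normal_Form.Matrix"
begin

(* Vectors and matrices are indexed from 0: the entry lambda_i of the mathematical
   text (1 <= i <= n) is lam $ (i - 1). The superscript k of gamma and its range are
   not shifted. *)

definition max_norm_vec :: "real vec \<Rightarrow> real" where
  "max_norm_vec v = Max (abs ` set\<^sub>v v)"

definition max_norm_mat :: "real mat \<Rightarrow> real" where
  "max_norm_mat M = Max (abs ` elements_mat M)"

definition frobenius_norm :: "real mat \<Rightarrow> real" where
  "frobenius_norm M = sqrt (\<Sum>i<dim_row M. \<Sum>j<dim_col M. (M $$ (i, j))\<^sup>2)"

definition ones :: "nat \<Rightarrow> real vec" where
  "ones n = vec n (\<lambda>_. 1)"

(* The row vector beta P is the transpose of P applied to beta. *)
definition op_feasible :: "nat \<Rightarrow> real vec \<Rightarrow> real mat \<Rightarrow> bool" where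
  "op_feasible n beta P \<longleftrightarrow>
     P \<in> carrier_mat n n \<and> P *\<^sub>v ones n = ones n \<and> 0\<^sub>v n \<le> transpose_mat P *\<^sub>v beta"

definition op_objective :: "nat \<Rightarrow> real vec \<Rightarrow> real mat \<Rightarrow> real mat \<Rightarrow> real" where
  "op_objective n lam A P = (frobenius_norm (P * A - mat_diag n (\<lambda>i. lam $ i) * P))\<^sup>2"

definition op_optimal :: "nat \<Rightarrow> real vec \<Rightarrow> real vec \<Rightarrow> real mat \<Rightarrow> real mat \<Rightarrow> bool" where
  "op_optimal n lam beta A P \<longleftrightarrow> is_arg_min (op_objective n lam A) (op_feasible n beta) P"

(* gam n lam beta k i is gamma_{i+1}^{(k)}, for 1 <= k <= n - 1 and i < n. With indices
   from 0, the cyclic shift [i + k]_n becomes (i + k) mod n. The value at k = 0 is a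
   dummy. *)
fun gam :: "nat \<Rightarrow> real vec \<Rightarrow> real vec \<Rightarrow> nat \<Rightarrow> nat \<Rightarrow> real" where
  "gam n lam beta 0 i = 0"
| "gam n lam beta (Suc 0) i = (beta $ i)\<^sup>2"
| "gam n lam beta (Suc (Suc k)) i =
     gam n lam beta (Suc k) i * gam n lam beta (Suc k) ((i + 1) mod n)
       * (lam $ i - lam $ ((i + Suc k) mod n))\<^sup>2
     / (gam n lam beta (Suc k) i + gam n lam beta (Suc k) ((i + 1) mod n))"

definition eta :: "nat \<Rightarrow> real vec \<Rightarrow> real" where
  "eta n beta = Max {\<bar>beta $ l\<bar> / \<bar>beta $ i\<bar> | i l. i \<le> l \<and> l < n}"

definition rho_bar :: "nat \<Rightarrow> real vec \<Rightarrow> real vec \<Rightarrow> real" where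
  "rho_bar n lam beta =
     (real n + lam $ 0)\<^sup>2
     * ((real n - 1) * real n * (2 * real n - 1) / 3 * (eta n beta)\<^sup>2
        + real n * (real n - 1) * eta n beta + real n)"

(* The index [n + i - 1]_n (1 <= i <= n) becomes (n + i - 1) mod n (i < n). *)
definition rho :: "nat \<Rightarrow> real vec \<Rightarrow> real vec \<Rightarrow> real" where
  "rho n lam beta =
     2 ^ (n * (n - 2))
     * ((\<Sum>i<n. gam n lam beta (n - 1) i)
        / (\<Sum>j<n. \<Sum>i<j. gam n lam beta (n - 1) i * gam n lam beta (n - 1) j
             * (lam $ ((n + i - 1) mod n) - lam $ ((n + j - 1) mod n))\<^sup>2)) ^ n
     * ((max_norm_vec beta)\<^sup>2 + 4) ^ (n\<^sup>2 - 1)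
     * fact (n\<^sup>2 - 1)
     * (real n + lam $ 0 + max_norm_vec beta)
     * max (sqrt (rho_bar n lam beta)) 1"

end

theory Submission
  imports Defs
begin

text \<open>Put \<open>Q = P A - diag \<lambda> P\<close>. Optimality bounds \<open>Q\<close> by comparison with the matrix all of whose
  rows are the first unit vector. Since \<open>\<beta> P\<close> is a probability vector and \<open>A\<close> is substochastic,
  the l1-norms of the vectors \<open>\<beta> f(diag \<lambda>) P\<close> are controlled for products \<open>f\<close> of factors
  \<open>x - \<lambda>\<^sub>m\<close>; the product over all \<open>m \<noteq> q\<close> isolates row \<open>q\<close> of \<open>P\<close> with the
  coefficient \<open>z\<^sub>q\<close>, where \<open>\<bar>z\<^sub>q\<bar> = \<bar>\<beta>\<^sub>q\<bar> \<Prod>\<^bsub>m \<noteq> q\<^esub> \<bar>\<lambda>\<^sub>q - \<lambda>\<^sub>m\<bar>\<close>.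

  Let \<open>S\<close> be the quotient of sums of \<open>\<gamma>\<close>s in \<open>\<rho>\<close>. The numbers \<open>1/\<gamma>\<close> satisfy a recursion like that of
  squared divided differences. Comparing with the divided differences of a function
  supported at \<open>q\<close> bounds \<open>\<gamma>\<close> above by a multiple of a partial product of \<open>z\<^sub>q\<^sup>2\<close>, and a
  variance inequality then gives \<open>1 \<le> (n - 1) 2\<^bsup>n - 2\<^esup> z\<^sub>q\<^sup>2 S\<close>. This is a lower bound for
  \<open>z\<^sub>q\<close> that turns the estimate for row \<open>q\<close> into one in terms of \<open>S\<close>.\<close>

section \<open>Upper bounds for the \<open>\<gamma>\<close>s by products of squared gaps\<close>

text \<open>After \<open>(x - y)\<^sup>2 \<le> 2 * (x\<^sup>2 + y\<^sup>2)\<close> the bounds are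
  used crosswise: the one for \<open>c\<close> on the term with \<open>x\<^sup>2\<close>, the one
  for \<open>a\<close> on the term with \<open>y\<^sup>2\<close>. Both terms then carry
  \<open>m * x\<^sup>2 * y\<^sup>2\<close>, and \<open>a + c\<close> cancels.\<close>

lemma parallel_sum_le:
  fixes a c x y :: real
  assumes "0 < a" "0 < c" "0 \<le> m" "a \<le> m * x\<^sup>2" "c \<le> m * y\<^sup>2"
  shows "a * c * (x - y)\<^sup>2 / (a + c) \<le> 2 * m * x\<^sup>2 * y\<^sup>2"
proof -
  have "(x - y)\<^sup>2 \<le> 2 * (x\<^sup>2 + y\<^sup>2)"
    using zero_le_power2[of "x + y"] by (simp add: power2_eq_square algebra_simps)
  then have "a * c * (x - y)\<^sup>2 \<le> a * c * (2 * (x\<^sup>2 + y\<^sup>2))"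
    using assms by (intro mult_left_mono) auto
  also have "\<dots> = 2 * (a * (c * x\<^sup>2) + c * (a * y\<^sup>2))"
    by (simp add: algebra_simps)
  also have "\<dots> \<le> 2 * (a * (m * y\<^sup>2 * x\<^sup>2) + c * (m * x\<^sup>2 * y\<^sup>2))"
    using assms by (intro mult_left_mono add_mono mult_right_mono) auto
  also have "\<dots> = 2 * m * x\<^sup>2 * y\<^sup>2 * (a + c)"
    by (simp add: algebra_simps)
  finally show ?thesis
    using assms by (simp add: field_simps)
qed

lemma parallel_le:
  fixes a c d :: real
  assumes "0 < a" "0 < c"
  shows "a * c * d\<^sup>2 / (a + c) \<le> a * d\<^sup>2" "a * c * d\<^sup>2 / (a + c) \<le> c * d\<^sup>2"
  using assms by (auto simp: field_simps)

lemma mod_add_neq: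
  fixes i k n :: nat
  assumes "i < n" "0 < k" "k < n"
  shows "(i + k) mod n \<noteq> i"
  using assms by (cases "i + k < n") (auto simp: le_mod_geq)

lemma gam_pos:
  assumes "\<And>i. i < n \<Longrightarrow> beta $ i \<noteq> 0" "inj_on (vec_index lam) {..<n}"
    and "k < n - 1" "i < n"
  shows "0 < gam n lam beta (Suc k) i"
  using assms(3,4)
proof (induction k arbitrary: i)
  case 0
  then show ?case using assms(1) by simp
next
  case (Suc k)
  have "(i + Suc k) mod n \<noteq> i"
    using Suc.prems by (intro mod_add_neq) auto
  then have "lam $ i \<noteq> lam $ ((i + Suc k) mod n)"
    using inj_onD[OF assms(2), of i "(i + Suc k) mod n"] Suc.prems by auto
  moreover have "0 < gam n lam beta (Suc k) i" "0 < gam n lam beta (Suc k) ((i + 1) mod n)"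
    using Suc by auto
  ultimately show ?case by simp
qed

text \<open>\<open>gam n lam beta (Suc k) i\<close> involves the cyclic window of nodes
  \<open>i, ..., i + k\<close>, in which \<open>q\<close> has offset \<open>s\<close>. Its two
  predecessors belong to the windows without the last and without the first node. If
  \<open>q\<close> is an end node, it lies in only one of them, and \<open>a * c / (a + c)\<close>
  is bounded by that one; if \<open>q\<close> is interior, both bounds combine through
  \<open>parallel_sum_le\<close>, at the cost of a factor 2 per step.\<close>

lemma gam_le:
  assumes b: "\<And>i. i < n \<Longrightarrow> beta $ i \<noteq> 0" and l: "inj_on (vec_index lam) {..<n}"
    and "k < n - 1" "i < n" "s \<le> k" "q = (i + s) mod n"
  shows "gam n lam beta (Suc k) i
    \<le> 2 ^ k * (beta $ q)\<^sup>2 * (\<Prod>t\<in>{..k}-{s}. (lam $ q - lam $ ((i + t) mod n))\<^sup>2)"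
  using assms(3-6)
proof (induction k arbitrary: i s)
  case 0
  then show ?case by simp
next
  case (Suc k)
  let ?f = "\<lambda>t. (lam $ q - lam $ ((i + t) mod n))\<^sup>2"
  let ?a = "gam n lam beta (Suc k) i" and ?c = "gam n lam beta (Suc k) ((i + 1) mod n)"
  let ?d = "lam $ i - lam $ ((i + Suc k) mod n)"
  have pos: "0 < ?a" "0 < ?c"
    using Suc.prems by (auto intro!: gam_pos[OF b l])
  have eq: "gam n lam beta (Suc (Suc k)) i = ?a * ?c * ?d\<^sup>2 / (?a + ?c)"
    by simp
  have n: "n > 0" "i mod n = i" using Suc.prems by auto
  have A: "?a \<le> 2 ^ k * (beta $ q)\<^sup>2 * (\<Prod>t\<in>{..k}-{s}. ?f t)" if "s \<le> k"
    using Suc that by auto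
  \<comment> \<open>In the window starting at \<open>i + 1\<close> the offset of \<open>q\<close>
    drops to \<open>s - 1\<close>, which needs \<open>s > 0\<close>.\<close>
  have C: "?c \<le> 2 ^ k * (beta $ q)\<^sup>2 * (\<Prod>t\<in>{1..Suc k}-{s}. ?f t)" if "s > 0"
  proof -
    have "(i + s) mod n = ((i + 1) mod n + (s - 1)) mod n"
      using mod_add_left_eq[of "i + 1" n "s - 1"] that by simp
    then have "?c \<le> 2 ^ k * (beta $ q)\<^sup>2
        * (\<Prod>t\<in>{..k}-{s-1}. (lam $ q - lam $ (((i + 1) mod n + t) mod n))\<^sup>2)"
      using Suc.prems that n by (intro Suc.IH) auto
    also have "(\<Prod>t\<in>{..k}-{s-1}. (lam $ q - lam $ (((i + 1) mod n + t) mod n))\<^sup>2)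
        = (\<Prod>t\<in>{1..Suc k}-{s}. ?f t)"
      by (rule prod.reindex_bij_witness[of _ "\<lambda>t. t - 1" Suc])
        (use that in \<open>auto simp: mod_add_left_eq\<close>)
    finally show ?thesis .
  qed
  consider "s = 0" | "s = Suc k" | "0 < s" "s \<le> k" using Suc.prems by linarith
  then show ?case
  proof cases
    case 1
    have S: "{..Suc k} - {s} = insert (Suc k) ({..k} - {s})" using 1 by auto
    have "?a * ?c * ?d\<^sup>2 / (?a + ?c) \<le> ?a * ?d\<^sup>2" using pos by (rule parallel_le)
    also have "\<dots> \<le> (2 ^ k * (beta $ q)\<^sup>2 * (\<Prod>t\<in>{..k}-{s}. ?f t)) * ?f (Suc k)"
      using A 1 Suc.prems n by (intro mult_mono) (auto intro!: mult_nonneg_nonneg prod_nonneg)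
    also have "\<dots> \<le> 2 * \<dots>"
      by (auto intro!: mult_nonneg_nonneg prod_nonneg)
    also have "\<dots> = 2 ^ Suc k * (beta $ q)\<^sup>2 * (\<Prod>t\<in>{..Suc k}-{s}. ?f t)"
      unfolding S by simp
    finally show ?thesis unfolding eq .
  next
    case 2
    have S: "{..Suc k} - {s} = insert 0 ({1..Suc k} - {s})" using 2 by auto
    have "?a * ?c * ?d\<^sup>2 / (?a + ?c) \<le> ?c * ?d\<^sup>2" using pos by (rule parallel_le)
    also have "\<dots> \<le> (2 ^ k * (beta $ q)\<^sup>2 * (\<Prod>t\<in>{1..Suc k}-{s}. ?f t)) * ?f 0"
      using C 2 Suc.prems n
      by (intro mult_mono) (auto intro!: mult_nonneg_nonneg prod_nonneg simp: power2_commute)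
    also have "\<dots> \<le> 2 * \<dots>"
      by (auto intro!: mult_nonneg_nonneg prod_nonneg)
    also have "\<dots> = 2 ^ Suc k * (beta $ q)\<^sup>2 * (\<Prod>t\<in>{..Suc k}-{s}. ?f t)"
      unfolding S by simp
    finally show ?thesis unfolding eq .
  next
    case 3
    let ?m = "2 ^ k * (beta $ q)\<^sup>2 * (\<Prod>t\<in>{1..k}-{s}. ?f t)"
    have S: "{..k} - {s} = insert 0 ({1..k} - {s})"
      "{1..Suc k} - {s} = insert (Suc k) ({1..k} - {s})"
      "{..Suc k} - {s} = insert (Suc k) (insert 0 ({1..k} - {s}))"
      using 3 by auto
    have "?a \<le> ?m * ?f 0" using A 3 unfolding S by (simp add: mult_ac)
    moreover have "?c \<le> ?m * ?f (Suc k)" using C 3 unfolding S by (simp add: mult_ac)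
    moreover have "0 \<le> ?m" by (auto intro!: mult_nonneg_nonneg prod_nonneg)
    \<comment> \<open>Up to sign, the gap between the end nodes is the difference of their distances
      from \<open>lam $ q\<close>, the form that \<open>parallel_sum_le\<close> expects.\<close>
    ultimately have "?a * ?c * ((lam $ q - lam $ ((i + 0) mod n))
          - (lam $ q - lam $ ((i + Suc k) mod n)))\<^sup>2 / (?a + ?c)
        \<le> 2 * ?m * ?f 0 * ?f (Suc k)"
      using pos by (intro parallel_sum_le)
    also have "\<dots> = 2 ^ Suc k * (beta $ q)\<^sup>2 * (\<Prod>t\<in>{..Suc k}-{s}. ?f t)"
      unfolding S by (simp add: mult_ac)
    finally show ?thesis unfolding eq using n by (simp add: power2_commute)
  qed
qed

section \<open>A variance inequality and the lower bound for the quotient of \<open>\<gamma>\<close>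
  sums\<close>

lemma sum_pairs_lessThan:
  fixes f :: "nat \<Rightarrow> nat \<Rightarrow> real"
  assumes "\<And>i j. f i j = f j i" "\<And>i. f i i = 0"
  shows "(\<Sum>j<n. \<Sum>i<n. f i j) = 2 * (\<Sum>j<n. \<Sum>i<j. f i j)"
proof (induction n)
  case (Suc n)
  have "(\<Sum>j<n. f n j) = (\<Sum>i<n. f i n)" using assms(1) by (intro sum.cong) auto
  with Suc show ?case by (simp add: sum.distrib assms(2))
qed simp

text \<open>By Lagrange's identity the difference of the two sides is the square of the first moment
  \<open>\<Sum>i<n. g i * (x i - c)\<close>.\<close>

lemma sum_pairs_le_moment:
  fixes g x :: "nat \<Rightarrow> real"
  shows "(\<Sum>j<n. \<Sum>i<j. g i * g j * (x i - x j)\<^sup>2)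
    \<le> (\<Sum>i<n. g i) * (\<Sum>i<n. g i * (x i - c)\<^sup>2)"
proof -
  let ?y = "\<lambda>i. x i - c"
  \<comment> \<open>Applied below with \<open>z i = g i * (x i - c)\<^sup>2\<close> and
    \<open>w i = g i * (x i - c)\<close>.\<close>
  have expand: "(\<Sum>j<n. \<Sum>i<n. g i * z j + g j * z i - 2 * (w i * w j))
      = 2 * ((\<Sum>i<n. g i) * (\<Sum>i<n. z i)) - 2 * (\<Sum>i<n. w i)\<^sup>2" for z w :: "nat \<Rightarrow> real"
    by (simp add: sum.distrib sum_subtractf sum_distrib_left[symmetric]
        sum_distrib_right[symmetric] power2_eq_square)
  have "2 * (\<Sum>j<n. \<Sum>i<j. g i * g j * (x i - x j)\<^sup>2)
      = (\<Sum>j<n. \<Sum>i<n. g i * g j * (x i - x j)\<^sup>2)"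
    by (rule sum_pairs_lessThan[symmetric]) (auto simp: power2_commute)
  also have "\<dots> = (\<Sum>j<n. \<Sum>i<n. g i * (g j * (?y j)\<^sup>2) + g j * (g i * (?y i)\<^sup>2)
      - 2 * ((g i * ?y i) * (g j * ?y j)))"
    by (intro sum.cong refl) (simp add: power2_eq_square algebra_simps)
  also have "\<dots> = 2 * ((\<Sum>i<n. g i) * (\<Sum>i<n. g i * (?y i)\<^sup>2)) - 2 * (\<Sum>i<n. g i * ?y i)\<^sup>2"
    by (rule expand)
  finally show ?thesis
    using zero_le_power2[of "\<Sum>i<n. g i * ?y i"] by linarith
qed

lemma bij_betw_add_mod:
  fixes i n :: nat
  assumes "0 < n"
  shows "bij_betw (\<lambda>t. (i + t) mod n) {..<n} {..<n}"
proof -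
  have "inj_on (\<lambda>t. (i + t) mod n) {..<n}"
  proof (rule linorder_inj_onI')
    fix t u assume tu: "t \<in> {..<n}" "u \<in> {..<n}" "t < u"
    then have "\<not> n dvd (i + u) - (i + t)" by (auto dest: dvd_imp_le)
    with tu show "(i + t) mod n \<noteq> (i + u) mod n"
      by (subst eq_commute, subst mod_eq_dvd_iff_nat) auto
  qed
  then show ?thesis
    using assms by (intro bij_betw_imageI endo_inj_surj) auto
qed

text \<open>The variance inequality, centred at \<open>lam $ q\<close>, bounds \<open>D\<close> by
  \<open>G\<close> times a moment. The window of \<open>gam n lam beta (n - 1) i\<close> omits
  exactly one node, the cyclic predecessor of \<open>i\<close>, and \<open>?x i\<close> is the value
  of \<open>lam\<close> there. So the factor \<open>(?x i - lam $ q)\<^sup>2\<close> supplies the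
  one gap that \<open>gam_le\<close> leaves out.\<close>

lemma gam_quotient_ge:
  assumes b: "\<And>i. i < n \<Longrightarrow> beta $ i \<noteq> 0" and l: "inj_on (vec_index lam) {..<n}"
    and n: "n = Suc (Suc k)" and q: "q < n"
    and D: "D = (\<Sum>j<n. \<Sum>i<j. gam n lam beta (n - 1) i * gam n lam beta (n - 1) j
             * (lam $ ((n + i - 1) mod n) - lam $ ((n + j - 1) mod n))\<^sup>2)"
    and G: "G = (\<Sum>i<n. gam n lam beta (n - 1) i)"
  shows "1 \<le> real (Suc k) * 2 ^ k
      * ((beta $ q)\<^sup>2 * (\<Prod>m\<in>{..<n}-{q}. (lam $ q - lam $ m)\<^sup>2)) * (G / D)"
proof -
  let ?g = "gam n lam beta (n - 1)"
  let ?x = "\<lambda>i. lam $ ((n + i - 1) mod n)"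
  let ?Z = "(beta $ q)\<^sup>2 * (\<Prod>m\<in>{..<n}-{q}. (lam $ q - lam $ m)\<^sup>2)"
  have gpos: "0 < ?g i" if "i < n" for i
    using gam_pos[OF b l, of k i] that n by simp
  have bij: "bij_betw (\<lambda>t. (i + t) mod n) {..<n} {..<n}" for i
    using n by (intro bij_betw_add_mod) auto
  have term_le: "?g i * (?x i - lam $ q)\<^sup>2 \<le> 2 ^ k * ?Z" if i: "i < n" "i \<noteq> (q + 1) mod n" for i
  proof -
    obtain s where s: "s < n" "q = (i + s) mod n"
      using bij_betw_imp_surj_on[OF bij[of i]] q by (metis (no_types, lifting) image_iff lessThan_iff)
    \<comment> \<open>Offset \<open>n - 1\<close> would make \<open>q\<close> the omitted node, that
      is, \<open>i\<close> the cyclic successor of \<open>q\<close>.\<close>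
    have "s \<noteq> Suc k"
    proof
      assume "s = Suc k"
      then have "(q + 1) mod n = (i + n) mod n" using s n by (simp add: mod_Suc_eq)
      with i show False by simp
    qed
    with s n have sk: "s \<le> k" by simp
    have "?g i \<le> 2 ^ k * (beta $ q)\<^sup>2 * (\<Prod>t\<in>{..k}-{s}. (lam $ q - lam $ ((i + t) mod n))\<^sup>2)"
      using gam_le[OF b l _ i(1) sk s(2)] n by simp
    then have "?g i * (?x i - lam $ q)\<^sup>2 \<le> 2 ^ k * (beta $ q)\<^sup>2
        * (\<Prod>t\<in>{..k}-{s}. (lam $ q - lam $ ((i + t) mod n))\<^sup>2) * (lam $ q - lam $ ((i + Suc k) mod n))\<^sup>2"
      using n by (intro mult_mono) (auto intro!: mult_nonneg_nonneg prod_nonneg simp: power2_commute add.commute)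
    also have "\<dots> = 2 ^ k * ((beta $ q)\<^sup>2
        * (\<Prod>t\<in>insert (Suc k) ({..k}-{s}). (lam $ q - lam $ ((i + t) mod n))\<^sup>2))"
      by simp
    also have "insert (Suc k) ({..k}-{s}) = {..<n} - {s}" using sk n by auto
    also have "(\<Prod>t\<in>{..<n}-{s}. (lam $ q - lam $ ((i + t) mod n))\<^sup>2)
        = (\<Prod>m\<in>{..<n}-{q}. (lam $ q - lam $ m)\<^sup>2)"
    proof (rule prod.reindex_bij_betw)
      show "bij_betw (\<lambda>t. (i + t) mod n) ({..<n} - {s}) ({..<n} - {q})"
        using bij[of i] s by (intro bij_betw_DiffI) (auto simp: bij_betw_def)
    qed
    finally show ?thesis .
  qed
  \<comment> \<open>The index whose omitted node is \<open>q\<close>: its moment term vanishes, so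
    \<open>n - 1\<close> terms remain.\<close>
  let ?p = "(q + 1) mod n"
  have p: "?p \<in> {..<n}" using n by simp
  have xp: "(n + ?p - 1) mod n = q"
  proof (cases "q + 1 = n")
    case True
    then show ?thesis using n by simp
  next
    case False
    with q have "n + ?p - 1 = n + q" by simp
    with q show ?thesis by simp
  qed
  have "(\<Sum>i<n. ?g i * (?x i - lam $ q)\<^sup>2) = (\<Sum>i\<in>{..<n}-{?p}. ?g i * (?x i - lam $ q)\<^sup>2)"
    using p xp by (subst sum.remove[of _ ?p]) auto
  also have "\<dots> \<le> (\<Sum>i\<in>{..<n}-{?p}. 2 ^ k * ?Z)"
    using term_le by (intro sum_mono) auto
  also have "\<dots> = real (Suc k) * 2 ^ k * ?Z"
    using p n by (simp add: card_Diff_singleton)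
  finally have mom: "(\<Sum>i<n. ?g i * (?x i - lam $ q)\<^sup>2) \<le> real (Suc k) * 2 ^ k * ?Z" .
  have Gpos: "0 < G" unfolding G using gpos n by (intro sum_pos) auto
  have "D \<le> G * (\<Sum>i<n. ?g i * (?x i - lam $ q)\<^sup>2)"
    unfolding D G by (rule sum_pairs_le_moment)
  also have "\<dots> \<le> G * (real (Suc k) * 2 ^ k * ?Z)"
    using Gpos mom by (intro mult_left_mono) auto
  finally have DG: "D \<le> G * (real (Suc k) * 2 ^ k * ?Z)" .
  \<comment> \<open>Dividing by \<open>D\<close> requires \<open>0 < D\<close>. The pair of indices
    0 and 1 gives a positive summand, as it compares the distinct nodes \<open>n - 1\<close> and
    0.\<close>
  have "0 < ?g 0 * ?g 1 * (?x 0 - ?x 1)\<^sup>2"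
  proof -
    have "?x 0 \<noteq> ?x 1"
      using inj_onD[OF l, of "(n + 0 - 1) mod n" "(n + 1 - 1) mod n"] n by auto
    then show ?thesis using gpos[of 0] gpos[of 1] n by auto
  qed
  also have "\<dots> = (\<Sum>i<1. ?g i * ?g 1 * (?x i - ?x 1)\<^sup>2)" by simp
  also have "\<dots> \<le> D"
    unfolding D using n gpos[THEN less_imp_le]
    by (intro member_le_sum[of 1 _ "\<lambda>j. \<Sum>i<j. ?g i * ?g j * (?x i - ?x j)\<^sup>2"])
       (auto intro!: sum_nonneg mult_nonneg_nonneg)
  finally have "0 < D" .
  with DG show ?thesis by (simp add: field_simps)
qed

section \<open>Norm estimates and the isolation of a row of \<open>P\<close>\<close>

lemma sum_power2_le_power2_sum:
  fixes f :: "'a \<Rightarrow> real"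
  shows "finite I \<Longrightarrow> (\<And>i. i \<in> I \<Longrightarrow> 0 \<le> f i) \<Longrightarrow> (\<Sum>i\<in>I. (f i)\<^sup>2) \<le> (\<Sum>i\<in>I. f i)\<^sup>2"
proof (induction I rule: finite_induct)
  case (insert x I)
  have "0 \<le> f x * sum f I" using insert by (intro mult_nonneg_nonneg sum_nonneg) auto
  then show ?case using insert by (simp add: power2_sum)
qed simp

lemma sum_abs_vec_mult_le:
  fixes w :: "nat \<Rightarrow> real" and a :: "nat \<Rightarrow> nat \<Rightarrow> real"
  assumes "\<And>i j. i < n \<Longrightarrow> j < n \<Longrightarrow> 0 \<le> a i j" "\<And>i. i < n \<Longrightarrow> (\<Sum>j<n. a i j) \<le> 1"
  shows "(\<Sum>j<n. \<bar>\<Sum>i<n. w i * a i j\<bar>) \<le> (\<Sum>i<n. \<bar>w i\<bar>)"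
proof -
  have "(\<Sum>j<n. \<bar>\<Sum>i<n. w i * a i j\<bar>) \<le> (\<Sum>j<n. \<Sum>i<n. \<bar>w i\<bar> * a i j)"
    using assms(1) by (intro sum_mono order_trans[OF sum_abs]) (auto simp: abs_mult)
  also have "\<dots> = (\<Sum>i<n. \<bar>w i\<bar> * (\<Sum>j<n. a i j))"
    by (subst sum.swap) (simp add: sum_distrib_left)
  also have "\<dots> \<le> (\<Sum>i<n. \<bar>w i\<bar>)"
    using assms(2) by (intro sum_mono mult_left_le) auto
  finally show ?thesis .
qed

text \<open>Each factor \<open>diag \<lambda> - \<lambda>\<^sub>m\<close> at most doubles the l1-norm, up to a multiple of the residual,
  because \<open>diag \<lambda> P = P A - Q\<close> and \<open>A\<close> is substochastic.\<close>
lemma sum_abs_annihilated_le: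
  fixes p q a :: "nat \<Rightarrow> nat \<Rightarrow> real" and \<beta> \<mu> :: "nat \<Rightarrow> real"
  assumes a: "\<And>i j. i < n \<Longrightarrow> j < n \<Longrightarrow> 0 \<le> a i j" "\<And>i. i < n \<Longrightarrow> (\<Sum>j<n. a i j) \<le> 1"
    and q: "\<And>l j. l < n \<Longrightarrow> j < n \<Longrightarrow> q l j = (\<Sum>i<n. p l i * a i j) - \<mu> l * p l j"
    and \<mu>: "\<And>l. l < n \<Longrightarrow> \<bar>\<mu> l\<bar> \<le> 1"
    and \<beta>: "\<And>l. l < n \<Longrightarrow> \<bar>\<beta> l\<bar> \<le> b"
    and start: "(\<Sum>j<n. \<bar>\<Sum>l<n. \<beta> l * p l j\<bar>) \<le> 1"
    and "finite D" "D \<subseteq> {..<n}"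
  shows "(\<Sum>j<n. \<bar>\<Sum>l<n. \<beta> l * (\<Prod>m\<in>D. \<mu> l - \<mu> m) * p l j\<bar>)
    \<le> 2 ^ card D * (1 + card D * (b * (\<Sum>l<n. \<Sum>j<n. \<bar>q l j\<bar>)) / 2)"
  using assms(7,8)
proof (induction D rule: finite_induct)
  case empty
  then show ?case using start by simp
next
  case (insert m D)
  let ?B = "b * (\<Sum>l<n. \<Sum>j<n. \<bar>q l j\<bar>)"
  let ?c = "\<lambda>l. \<beta> l * (\<Prod>m\<in>D. \<mu> l - \<mu> m)"
  let ?w = "\<lambda>j. \<Sum>l<n. ?c l * p l j"
  have m: "m < n" using insert by auto
  \<comment> \<open>Replacing \<open>\<mu> l * p l j\<close> by
    \<open>(\<Sum>i<n. p l i * a i j) - q l j\<close> turns a multiplier that depends on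
    \<open>l\<close> into right multiplication of the row vector \<open>?w\<close> by
    \<open>a\<close>.\<close>
  have step: "(\<Sum>l<n. \<beta> l * (\<Prod>m\<in>insert m D. \<mu> l - \<mu> m) * p l j)
      = (\<Sum>i<n. ?w i * a i j) - (\<Sum>l<n. ?c l * q l j) - \<mu> m * ?w j" if j: "j < n" for j
  proof -
    have "(\<Sum>i<n. ?w i * a i j) = (\<Sum>l<n. ?c l * (\<Sum>i<n. p l i * a i j))"
      by (simp add: sum_distrib_left sum_distrib_right mult.assoc) (rule sum.swap)
    also have "\<dots> = (\<Sum>l<n. ?c l * (q l j + \<mu> l * p l j))"
      using j q by (intro sum.cong) auto
    finally show ?thesis
      using insert by (simp add: sum.distrib sum_subtractf sum_distrib_left algebra_simps)
  qed
  have c: "\<bar>?c l\<bar> \<le> b * 2 ^ card D" if l: "l < n" for l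
  proof -
    have "\<bar>\<mu> l - \<mu> m\<bar> \<le> 2" if "m \<in> D" for m
      using \<mu>[OF l] \<mu>[of m] insert.prems that by (auto simp: abs_le_iff)
    then have "(\<Prod>m\<in>D. \<bar>\<mu> l - \<mu> m\<bar>) \<le> (\<Prod>m\<in>D. 2)" by (intro prod_mono) auto
    moreover have "0 \<le> b" using \<beta>[OF l] by linarith
    ultimately show ?thesis
      using \<beta>[OF l] by (auto simp: abs_mult abs_prod intro!: mult_mono prod_nonneg)
  qed
  have "(\<Sum>j<n. \<bar>\<Sum>l<n. ?c l * q l j\<bar>) \<le> (\<Sum>j<n. \<Sum>l<n. (b * 2 ^ card D) * \<bar>q l j\<bar>)"
    using c by (intro sum_mono order_trans[OF sum_abs]) (auto simp: abs_mult intro!: mult_right_mono)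
  also have "\<dots> = 2 ^ card D * ?B"
    by (subst sum.swap) (simp add: sum_distrib_left mult_ac)
  finally have cq: "(\<Sum>j<n. \<bar>\<Sum>l<n. ?c l * q l j\<bar>) \<le> 2 ^ card D * ?B" .
  have IH: "(\<Sum>j<n. \<bar>?w j\<bar>) \<le> 2 ^ card D * (1 + card D * ?B / 2)"
    using insert by simp
  have "(\<Sum>j<n. \<bar>\<Sum>l<n. \<beta> l * (\<Prod>m\<in>insert m D. \<mu> l - \<mu> m) * p l j\<bar>)
      \<le> (\<Sum>j<n. \<bar>\<Sum>i<n. ?w i * a i j\<bar> + \<bar>\<Sum>l<n. ?c l * q l j\<bar> + \<bar>?w j\<bar>)"
  proof (intro sum_mono)
    fix j assume j: "j \<in> {..<n}"
    have "\<bar>\<mu> m * ?w j\<bar> \<le> \<bar>?w j\<bar>"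
      using \<mu>[OF m] by (simp add: abs_mult mult_left_le_one_le)
    then show "\<bar>\<Sum>l<n. \<beta> l * (\<Prod>m\<in>insert m D. \<mu> l - \<mu> m) * p l j\<bar>
        \<le> \<bar>\<Sum>i<n. ?w i * a i j\<bar> + \<bar>\<Sum>l<n. ?c l * q l j\<bar> + \<bar>?w j\<bar>"
      using j by (subst step) auto
  qed
  also have "\<dots> \<le> (\<Sum>j<n. \<bar>?w j\<bar>) + 2 ^ card D * ?B + (\<Sum>j<n. \<bar>?w j\<bar>)"
  proof -
    have "(\<Sum>j<n. \<bar>\<Sum>i<n. ?w i * a i j\<bar>) \<le> (\<Sum>j<n. \<bar>?w j\<bar>)"
      by (intro sum_abs_vec_mult_le a)
    with cq show ?thesis by (simp only: sum.distrib)
  qed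
  \<comment> \<open>The recursion is \<open>W (d + 1) \<le> 2 * W d + 2 ^ d * B\<close> with
    \<open>W 0 \<le> 1\<close>; its solution is \<open>2 ^ d * (1 + d * B / 2)\<close>.\<close>
  also have "\<dots> \<le> 2 * (2 ^ card D * (1 + card D * ?B / 2)) + 2 ^ card D * ?B"
    using IH by linarith
  also have "\<dots> = 2 ^ card (insert m D) * (1 + card (insert m D) * ?B / 2)"
    using insert by (simp add: algebra_simps)
  finally show ?case .
qed

text \<open>Each row \<open>l\<close> other than \<open>q\<close> is killed by its own factor
  \<open>m = l\<close>.\<close>

lemma annihilated_row:
  fixes \<beta> \<mu> :: "nat \<Rightarrow> real" and p :: "nat \<Rightarrow> nat \<Rightarrow> real"
  assumes "q < n"
  shows "(\<Sum>l<n. \<beta> l * (\<Prod>m\<in>{..<n}-{q}. \<mu> l - \<mu> m) * p l j)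
    = \<beta> q * (\<Prod>m\<in>{..<n}-{q}. \<mu> q - \<mu> m) * p q j"
proof -
  have "(\<Prod>m\<in>{..<n}-{q}. \<mu> l - \<mu> m) = 0" if "l \<in> {..<n} - {q}" for l
    using that by (intro prod_zero) auto
  then have "(\<Sum>l\<in>{..<n}-{q}. \<beta> l * (\<Prod>m\<in>{..<n}-{q}. \<mu> l - \<mu> m) * p l j) = 0"
    by (intro sum.neutral) (simp del: prod_zero_iff)
  then show ?thesis using assms by (subst sum.remove[of _ q]) auto
qed

section \<open>Arithmetic of the constants in \<open>rho\<close>\<close>

text \<open>The factorial contains the \<open>n\<^sup>2 - n\<close> factors from \<open>n\<close> to
  \<open>n\<^sup>2 - 1\<close>, each at least \<open>n\<close>, while the left side is at most
  \<open>n ^ (n + 3)\<close>. The exponents compare correctly from \<open>n = 3\<close> on; for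
  \<open>n = 2\<close> the claim reads \<open>4 \<le> 6\<close>.\<close>

lemma mult_power_le_fact:
  fixes n :: nat
  assumes "2 \<le> n"
  shows "n\<^sup>2 * (n - 1) ^ (n + 1) \<le> fact (n\<^sup>2 - 1)"
proof (cases "n = 2")
  case True
  then show ?thesis by (simp add: fact_numeral)
next
  case False
  with assms have n: "3 \<le> n" by simp
  have nn: "3 * n \<le> n * n" using n by (intro mult_right_mono) auto
  have "n\<^sup>2 * (n - 1) ^ (n + 1) \<le> n\<^sup>2 * n ^ (n + 1)"
    by (intro mult_left_mono power_mono) auto
  also have "\<dots> = n ^ (n + 3)" by (simp add: power2_eq_square numeral_3_eq_3)
  also have "\<dots> \<le> n ^ (n\<^sup>2 - n)"
  proof (rule power_increasing)
    have "3 * (n - 1) \<le> n * (n - 1)" using n by (intro mult_right_mono) auto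
    with n show "n + 3 \<le> n\<^sup>2 - n" by (simp add: power2_eq_square diff_mult_distrib2)
  qed (use n in auto)
  also have "\<dots> = (\<Prod>i\<in>{n..n\<^sup>2 - 1}. n)"
    using n nn by (simp add: power2_eq_square)
  also have "\<dots> \<le> \<Prod>{n..n\<^sup>2 - 1}" by (intro prod_mono) auto
  also have "\<dots> \<le> \<Prod>{1..n\<^sup>2 - 1}"
    using n by (intro dvd_imp_le prod_dvd_prod_subset) (auto intro!: prod_pos)
  also have "\<dots> = fact (n\<^sup>2 - 1)" by (simp add: fact_prod)
  finally show ?thesis .
qed

text \<open>Here \<open>p\<close> stands for the absolute value of an entry of \<open>P\<close>,
  \<open>z\<close> for the coefficient isolating its row, \<open>b\<close> for the norm of
  \<open>beta\<close>, \<open>r\<close> for the Frobenius norm of the residual, and \<open>x\<close>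
  for the first eigenvalue.\<close>

lemma le_rho_form_of_estimates:
  fixes p z b S R r x :: real
  assumes n: "n = Suc (Suc k)"
    and "0 \<le> p" "0 < z" "0 < S" "0 < b" "0 \<le> x"
    and r: "0 \<le> r" "r \<le> R" "1 \<le> R"
    and pz: "p * z \<le> 2 ^ (n - 1) * (1 + real (n - 1) * (b * (real (n\<^sup>2) * r)) / 2)"
    and z: "z \<le> b * 2 ^ (n - 1)"
    and S: "1 \<le> real (Suc k) * 2 ^ k * z\<^sup>2 * S"
  shows "p \<le> 2 ^ (n * (n - 2)) * S ^ n * (b\<^sup>2 + 4) ^ (n\<^sup>2 - 1) * fact (n\<^sup>2 - 1)
    * (real n + x + b) * R"
proof -
  define u where "u = b\<^sup>2 + 4"
  define C where "C = real (Suc k) * 2 ^ k"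
  have C: "0 < C" unfolding C_def by simp
  define N where "N = real (n\<^sup>2) * real (Suc k)"
  have N: "1 \<le> N"
    unfolding N_def using mult_mono[of 1 "real (n\<^sup>2)" 1 "real (Suc k)"] by (simp add: n)
  \<comment> \<open>The summand 2 appears because \<open>2 ^ (n - 1)\<close> is written as
    \<open>2 ^ k * 2\<close>; it is absorbed by \<open>real n * R\<close>.\<close>
  have num_le: "2 + N * (b * r) \<le> N * ((real n + x + b) * R)"
  proof -
    have "2 * 1 \<le> real n * R" using r unfolding n by (intro mult_mono) auto
    with N have "1 * (2 * 1) \<le> N * (real n * R)"
      using r by (intro mult_mono[of 1]) auto
    moreover have "N * (b * r) \<le> N * (b * R)"
      using assms(5) r N by (intro mult_left_mono[of _ _ N] mult_left_mono[of _ _ b]) auto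
    moreover have "0 \<le> N * (x * R)"
      using assms(6) r N by (intro mult_nonneg_nonneg) auto
    ultimately show ?thesis by (simp add: distrib_left distrib_right)
  qed
  have "2 ^ (n - 1) * (1 + real (n - 1) * (b * (real (n\<^sup>2) * r)) / 2) = 2 ^ k * (2 + N * (b * r))"
    unfolding N_def n by (simp add: algebra_simps)
  also have "\<dots> \<le> 2 ^ k * (N * ((real n + x + b) * R))" (is "_ \<le> ?L")
    using num_le by (rule mult_left_mono) auto
  finally have pL0: "2 ^ (n - 1) * (1 + real (n - 1) * (b * (real (n\<^sup>2) * r)) / 2) \<le> ?L" .
  with pz have pL: "p * z \<le> ?L" by linarith
  have L0: "0 \<le> ?L" using assms N by (intro mult_nonneg_nonneg) auto
  \<comment> \<open>This is \<open>4 * b \<le> b\<^sup>2 + 4\<close>; it handles the odd power of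
    \<open>b\<close> and also gains a factor 4.\<close>
  have bu: "b \<le> u / 4"
    using zero_le_power2[of "b - 2"] unfolding u_def by (simp add: power2_eq_square algebra_simps)
  have u4: "4 \<le> u" "b\<^sup>2 \<le> u" unfolding u_def by auto
  have "1 \<le> (C * z\<^sup>2 * S) ^ n"
    using S unfolding C_def by (intro one_le_power)
  \<comment> \<open>The inserted power contains \<open>2 * n\<close> factors \<open>z\<close>. One
    forms \<open>p * z\<close>; the other \<open>2 * k + 3\<close> are bounded by
    \<open>b * 2 ^ (n - 1)\<close>. This is the source of \<open>S ^ n\<close>.\<close>
  then have "p \<le> p * (C * z\<^sup>2 * S) ^ n"
    using mult_left_mono[of 1 _ p] assms(2) by simp
  also have "(C * z\<^sup>2 * S) ^ n = C ^ n * z ^ (2 * n) * S ^ n"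
    by (simp only: power_mult_distrib power_mult)
  also have "2 * n = Suc (2 * k + 3)" by (simp add: n)
  also have "p * (C ^ n * z ^ Suc (2 * k + 3) * S ^ n) = (p * z) * (C ^ n * z ^ (2 * k + 3) * S ^ n)"
    by (simp only: power_Suc mult_ac)
  also have "\<dots> \<le> ?L * (C ^ n * (b * 2 ^ (n - 1)) ^ (2 * k + 3) * S ^ n)"
  proof (rule mult_mono[OF pL _ L0])
    have "z ^ (2 * k + 3) \<le> (b * 2 ^ (n - 1)) ^ (2 * k + 3)"
      using z assms(3) by (intro power_mono) auto
    then show "C ^ n * z ^ (2 * k + 3) * S ^ n \<le> C ^ n * (b * 2 ^ (n - 1)) ^ (2 * k + 3) * S ^ n"
      using assms(4) C by (intro mult_right_mono mult_left_mono) auto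
  qed (use assms(3,4) C in auto)
  also have "\<dots> = S ^ n * (real n + x + b) * R * (real (n\<^sup>2) * real (Suc k) ^ (n + 1))
      * (b ^ (2 * k + 3) * 2 ^ (k + k * n + (n - 1) * (2 * k + 3)))"
  proof -
    have "C ^ n = real (Suc k) ^ n * 2 ^ (k * n)"
      unfolding C_def by (simp only: power_mult_distrib power_mult)
    moreover have "(b * 2 ^ (n - 1)) ^ (2 * k + 3) = b ^ (2 * k + 3) * 2 ^ ((n - 1) * (2 * k + 3))"
      by (simp only: power_mult_distrib power_mult)
    ultimately show ?thesis
      by (simp only: N_def power_add power_one_right mult_ac)
  qed
  also have "\<dots> \<le> S ^ n * (real n + x + b) * R * fact (n\<^sup>2 - 1)
      * (2 ^ (n * (n - 2)) * u ^ (n\<^sup>2 - 1))"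
  proof (rule mult_mono[OF mult_left_mono])
    have nk: "n - 1 = Suc k" "2 \<le> n" by (simp_all add: n)
    have "real (n\<^sup>2 * Suc k ^ (n + 1)) \<le> real (fact (n\<^sup>2 - 1))"
      using mult_power_le_fact[OF nk(2), unfolded nk(1)] by (rule of_nat_mono)
    then show "real (n\<^sup>2) * real (Suc k) ^ (n + 1) \<le> fact (n\<^sup>2 - 1)"
      by (simp only: of_nat_mult of_nat_power of_nat_fact)
    \<comment> \<open>Powers of 4 are traded for powers of \<open>u\<close>: \<open>e\<close> of
      them by \<open>4 \<le> u\<close>, one more by \<open>b \<le> u / 4\<close>. The value of
      \<open>e\<close> makes the total exponent of \<open>u\<close> equal to
      \<open>n\<^sup>2 - 1\<close>; the powers of 2 then fit with one to spare.\<close>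
    define e where "e = k\<^sup>2 + 3 * k + 1"
    have k3: "2 * k + 3 = 2 * (k + 1) + 1" by simp
    have "b ^ (2 * k + 3) = (b\<^sup>2) ^ (k + 1) * b"
      unfolding k3 by (simp only: power_add power_mult power_one_right)
    also have "\<dots> \<le> u ^ (k + 1) * (u / 4)"
      using bu assms(5) power_mono[OF u4(2), of "k + 1"] u4(1) by (intro mult_mono[OF _ bu]) auto
    finally have bpow: "b ^ (2 * k + 3) \<le> u ^ (k + 1) * (u / 4)" .
    have "(4::real) ^ (e + 1) \<le> 4 * u ^ e"
      using power_mono[OF u4(1), of e] by simp
    with bpow have "b ^ (2 * k + 3) * 4 ^ (e + 1) \<le> u ^ (k + 1) * (u / 4) * (4 * u ^ e)"
      by (rule mult_mono) (use u4 in auto)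
    also have "\<dots> = u ^ (k + 1) * u * u ^ e" by simp
    also have "\<dots> = u ^ (k + 1 + 1 + e)" by (simp only: power_add power_one_right)
    also have "k + 1 + 1 + e = n\<^sup>2 - 1"
      by (simp add: n e_def power2_eq_square)
    finally have main: "b ^ (2 * k + 3) * 4 ^ (e + 1) \<le> u ^ (n\<^sup>2 - 1)" .
    have "k + k * n + (n - 1) * (2 * k + 3) \<le> n * (n - 2) + 2 * (e + 1)"
      by (simp add: n e_def power2_eq_square algebra_simps)
    then have "(2::real) ^ (k + k * n + (n - 1) * (2 * k + 3)) \<le> 2 ^ (n * (n - 2) + 2 * (e + 1))"
      by (intro power_increasing) auto
    also have "\<dots> = 2 ^ (n * (n - 2)) * 4 ^ (e + 1)"
      by (simp only: power_add power_mult) simp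
    finally have "b ^ (2 * k + 3) * 2 ^ (k + k * n + (n - 1) * (2 * k + 3))
        \<le> b ^ (2 * k + 3) * (2 ^ (n * (n - 2)) * 4 ^ (e + 1))"
      by (rule mult_left_mono) (use assms(5) in simp)
    also have "\<dots> = 2 ^ (n * (n - 2)) * (b ^ (2 * k + 3) * 4 ^ (e + 1))"
      by (simp only: mult_ac)
    also have "\<dots> \<le> 2 ^ (n * (n - 2)) * u ^ (n\<^sup>2 - 1)"
      by (rule mult_left_mono[OF main]) simp
    finally show "b ^ (2 * k + 3) * 2 ^ (k + k * n + (n - 1) * (2 * k + 3))
        \<le> 2 ^ (n * (n - 2)) * u ^ (n\<^sup>2 - 1)" .
  qed (use assms(4-6) r in auto)
  finally show ?thesis unfolding u_def by (simp only: mult_ac)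
qed

section \<open>The optimal value and its comparison with \<open>rho_bar\<close>\<close>

lemma op_objective_eq:
  assumes "A \<in> carrier_mat n n" "P \<in> carrier_mat n n"
  shows "op_objective n lam A P
    = (\<Sum>i<n. \<Sum>j<n. ((\<Sum>k<n. P $$ (i, k) * A $$ (k, j)) - lam $ i * P $$ (i, j))\<^sup>2)"
proof -
  have "(P * A - mat_diag n (\<lambda>i. lam $ i) * P) $$ (i, j)
      = (\<Sum>k<n. P $$ (i, k) * A $$ (k, j)) - lam $ i * P $$ (i, j)" if "i < n" "j < n" for i j
    using assms that
    by (subst mat_diag_mult_left[OF assms(2)]) (auto simp: scalar_prod_def lessThan_atLeast0)
  then show ?thesis
    using assms
    by (auto simp: op_objective_def frobenius_norm_def real_sqrt_pow2 sum_nonneg mat_diag_def)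
qed

text \<open>For the competitor \<open>P0\<close>, \<open>beta\<close> times \<open>P0\<close> is the
  first unit vector because the entries of \<open>beta\<close> sum to 1. Row \<open>i\<close> of its
  residual is row 0 of \<open>A\<close> minus \<open>lam $ i\<close> times that unit vector, so its
  l1-norm, and hence its l2-norm, is at most \<open>1 + x\<close>.\<close>

lemma op_optimal_objective_le:
  fixes lam :: "real vec"
  assumes n: "n > 0" and beta: "beta \<in> carrier_vec n" "(\<Sum>l<n. beta $ l) = 1"
    and A: "A \<in> carrier_mat n n" "\<And>i j. i < n \<Longrightarrow> j < n \<Longrightarrow> 0 \<le> A $$ (i, j)"
      "\<And>i. i < n \<Longrightarrow> (\<Sum>j<n. A $$ (i, j)) \<le> 1"
    and lam: "\<And>i. i < n \<Longrightarrow> \<bar>lam $ i\<bar> \<le> x"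
    and opt: "op_optimal n lam beta A P"
  shows "op_objective n lam A P \<le> real n * (1 + x)\<^sup>2"
proof -
  define P0 :: "real mat" where "P0 = mat n n (\<lambda>(i, j). if j = 0 then 1 else 0)"
  have P0: "P0 \<in> carrier_mat n n" by (simp add: P0_def)
  have "op_feasible n beta P0"
    unfolding op_feasible_def
  proof (intro conjI P0)
    show "P0 *\<^sub>v ones n = ones n"
      using n by (intro eq_vecI) (auto simp: P0_def ones_def scalar_prod_def)
    show "0\<^sub>v n \<le> transpose_mat P0 *\<^sub>v beta"
      using n beta by (auto simp: P0_def less_eq_vec_def scalar_prod_def lessThan_atLeast0)
  qed
  with opt have "op_objective n lam A P \<le> op_objective n lam A P0"
    by (auto simp: op_optimal_def is_arg_min_linorder)
  also have "\<dots> = (\<Sum>i<n. \<Sum>j<n. (A $$ (0, j) - lam $ i * P0 $$ (i, j))\<^sup>2)"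
    unfolding op_objective_eq[OF A(1) P0]
  proof (intro sum.cong refl)
    fix i j assume "i \<in> {..<n}" "j \<in> {..<n}"
    then have "(\<Sum>k<n. P0 $$ (i, k) * A $$ (k, j)) = (\<Sum>k<n. if k = 0 then A $$ (k, j) else 0)"
      by (intro sum.cong) (auto simp: P0_def)
    then show "((\<Sum>k<n. P0 $$ (i, k) * A $$ (k, j)) - lam $ i * P0 $$ (i, j))\<^sup>2
        = (A $$ (0, j) - lam $ i * P0 $$ (i, j))\<^sup>2"
      using n by simp
  qed
  also have "\<dots> \<le> (\<Sum>i<n. (1 + x)\<^sup>2)"
  proof (rule sum_mono)
    fix i assume "i \<in> {..<n}"
    then have i: "i < n" by simp
    have "(\<Sum>j<n. (A $$ (0, j) - lam $ i * P0 $$ (i, j))\<^sup>2)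
        = (\<Sum>j<n. \<bar>A $$ (0, j) - lam $ i * P0 $$ (i, j)\<bar>\<^sup>2)" by simp
    also have "\<dots> \<le> (\<Sum>j<n. \<bar>A $$ (0, j) - lam $ i * P0 $$ (i, j)\<bar>)\<^sup>2"
      by (intro sum_power2_le_power2_sum) auto
    also have "\<dots> \<le> (1 + x)\<^sup>2"
    proof (intro power_mono sum_nonneg)
      have "(\<Sum>j<n. \<bar>A $$ (0, j) - lam $ i * P0 $$ (i, j)\<bar>)
          \<le> (\<Sum>j<n. A $$ (0, j) + (if j = 0 then \<bar>lam $ i\<bar> else 0))"
      proof (rule sum_mono)
        fix j assume "j \<in> {..<n}"
        then show "\<bar>A $$ (0, j) - lam $ i * P0 $$ (i, j)\<bar>
            \<le> A $$ (0, j) + (if j = 0 then \<bar>lam $ i\<bar> else 0)"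
          using A(2)[OF n, of j] i by (auto simp: P0_def)
      qed
      also have "\<dots> = (\<Sum>j<n. A $$ (0, j)) + \<bar>lam $ i\<bar>"
        using n by (simp add: sum.distrib)
      also have "\<dots> \<le> 1 + x" using A(3)[OF n] lam[OF i] by simp
      finally show "(\<Sum>j<n. \<bar>A $$ (0, j) - lam $ i * P0 $$ (i, j)\<bar>) \<le> 1 + x" .
    qed auto
    finally show "(\<Sum>j<n. (A $$ (0, j) - lam $ i * P0 $$ (i, j))\<^sup>2) \<le> (1 + x)\<^sup>2" .
  qed
  finally show ?thesis by simp
qed

lemma eta_nonneg:
  assumes "0 < n"
  shows "0 \<le> eta n beta"
proof -
  let ?S = "{\<bar>beta $ l\<bar> / \<bar>beta $ i\<bar> | i l. i \<le> l \<and> l < n}"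
  have "?S \<subseteq> (\<lambda>(i, l). \<bar>beta $ l\<bar> / \<bar>beta $ i\<bar>) ` ({..<n} \<times> {..<n})"
    by force
  then have "finite ?S" by (rule finite_subset) simp
  then have "\<bar>beta $ 0\<bar> / \<bar>beta $ 0\<bar> \<le> eta n beta"
    unfolding eta_def using assms by (intro Max_ge) auto
  then show ?thesis by (rule order_trans[rotated]) simp
qed

text \<open>The summand \<open>n\<close> of the bracket yields the left side; the terms with
  \<open>eta\<close> are nonnegative.\<close>

lemma rho_bar_ge:
  assumes "1 \<le> n"
  shows "real n * (real n + lam $ 0)\<^sup>2 \<le> rho_bar n lam beta"
proof -
  have "0 \<le> (real n - 1) * real n * (2 * real n - 1) / 3 * (eta n beta)\<^sup>2
      + real n * (real n - 1) * eta n beta"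
    using assms eta_nonneg[of n beta]
    by (intro add_nonneg_nonneg mult_nonneg_nonneg divide_nonneg_nonneg) auto
  then have "(real n + lam $ 0)\<^sup>2 * real n \<le> rho_bar n lam beta"
    unfolding rho_bar_def by (intro mult_left_mono) auto
  then show ?thesis by (simp add: mult.commute)
qed

section \<open>Assembling the bound for the entries of \<open>P\<close>\<close>

theorem proposition3:
  fixes n :: nat and lam beta :: "real vec" and A P :: "real mat"
  assumes "n \<ge> 2"
    and "lam \<in> carrier_vec n"
    and "beta \<in> carrier_vec n"
    and "lam $ 0 < 1"
    and "\<And>i j. i < j \<Longrightarrow> j < n \<Longrightarrow> lam $ j < lam $ i"
    and "lam $ 0 > Max {\<bar>lam $ l\<bar> | l. l \<in> {1..<n}}"
    and "(\<Sum>l<n. beta $ l) = 1"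
    and "(\<Prod>l<n. beta $ l) \<noteq> 0"
    and "A \<in> carrier_mat n n"
    and "0\<^sub>m n n \<le> A"
    and "A *\<^sub>v ones n \<le> ones n"
    and "op_optimal n lam beta A P"
  shows "max_norm_mat P \<le> rho n lam beta"
proof -
  obtain k where n: "n = Suc (Suc k)"
    using assms(1) by (metis add_2_eq_Suc le_Suc_ex)
  define b where "b = max_norm_vec beta"
  define S where "S = (\<Sum>i<n. gam n lam beta (n - 1) i)
        / (\<Sum>j<n. \<Sum>i<j. gam n lam beta (n - 1) i * gam n lam beta (n - 1) j
             * (lam $ ((n + i - 1) mod n) - lam $ ((n + j - 1) mod n))\<^sup>2)"
  define q where "q l j = (\<Sum>i<n. P $$ (l, i) * A $$ (i, j)) - lam $ l * P $$ (l, j)" for l j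
  define r where "r = sqrt (op_objective n lam A P)"
  define R where "R = max (sqrt (rho_bar n lam beta)) 1"
  have lam_less: "\<bar>lam $ l\<bar> < lam $ 0" if "l \<in> {1..<n}" for l
  proof -
    have "\<bar>lam $ l\<bar> \<le> Max {\<bar>lam $ l\<bar> | l. l \<in> {1..<n}}"
      using that by (intro Max_ge) auto
    with assms(6) show ?thesis by simp
  qed
  have lam0: "0 < lam $ 0" using lam_less[of 1] n by auto
  have lam_le: "\<bar>lam $ l\<bar> \<le> lam $ 0" if "l < n" for l
    using lam_less[of l] lam0 that by (cases "l = 0") auto
  have lam_le1: "\<bar>lam $ l\<bar> \<le> 1" if "l < n" for l
    using lam_le[OF that] assms(4) by simp
  have inj: "inj_on (vec_index lam) {..<n}"
  proof (rule linorder_inj_onI')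
    fix i j assume "i < j" "j \<in> {..<n}"
    then show "lam $ i \<noteq> lam $ j" using assms(5)[of i j] by simp
  qed
  have beta0: "beta $ l \<noteq> 0" if "l < n" for l using assms(8) that by auto
  have beta_le: "\<bar>beta $ l\<bar> \<le> b" if "l < n" for l
    unfolding b_def max_norm_vec_def vec_set_def using assms(3) that by (intro Max_ge) auto
  have bpos: "0 < b" using beta_le[of 0] beta0[of 0] n by auto
  have Apos: "0 \<le> A $$ (i, j)" if "i < n" "j < n" for i j
    using assms(9,10) that by (auto simp: less_eq_mat_def)
  have Asum: "(\<Sum>j<n. A $$ (i, j)) \<le> 1" if "i < n" for i
    using assms(9,11) that
    by (auto simp: less_eq_vec_def ones_def scalar_prod_def lessThan_atLeast0)
  have feas: "op_feasible n beta P"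
    using assms(12) by (auto simp: op_optimal_def is_arg_min_def)
  then have P: "P \<in> carrier_mat n n" by (simp add: op_feasible_def)
  have Psum: "(\<Sum>j<n. P $$ (l, j)) = 1" if "l < n" for l
  proof -
    have "(P *\<^sub>v ones n) $ l = ones n $ l" using feas by (simp add: op_feasible_def)
    then show ?thesis using P that by (simp add: ones_def scalar_prod_def lessThan_atLeast0)
  qed
  have betaP: "0 \<le> (\<Sum>l<n. beta $ l * P $$ (l, j))" if "j < n" for j
    using feas P that assms(3)
    by (auto simp: op_feasible_def less_eq_vec_def scalar_prod_def lessThan_atLeast0 mult.commute)
  \<comment> \<open>By feasibility the absolute values drop, and the unit row sums of
    \<open>P\<close> leave the sum of \<open>beta\<close>.\<close>
  have start: "(\<Sum>j<n. \<bar>\<Sum>l<n. beta $ l * P $$ (l, j)\<bar>) \<le> 1"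
  proof -
    have "(\<Sum>j<n. \<bar>\<Sum>l<n. beta $ l * P $$ (l, j)\<bar>) = (\<Sum>j<n. \<Sum>l<n. beta $ l * P $$ (l, j))"
      using betaP by (intro sum.cong) auto
    also have "\<dots> = (\<Sum>l<n. beta $ l * (\<Sum>j<n. P $$ (l, j)))"
      by (subst sum.swap) (simp add: sum_distrib_left)
    also have "\<dots> = 1" using Psum assms(7) by simp
    finally show ?thesis by simp
  qed
  have obj: "op_objective n lam A P = (\<Sum>l<n. \<Sum>j<n. (q l j)\<^sup>2)"
    unfolding q_def by (rule op_objective_eq[OF assms(9) P])
  have r0: "0 \<le> r" unfolding r_def obj by (intro real_sqrt_ge_zero sum_nonneg) auto
  have rR: "r \<le> R"
  proof -
    have "op_objective n lam A P \<le> real n * (1 + lam $ 0)\<^sup>2"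
      using n assms(3,7,9,12) Apos Asum lam_le by (intro op_optimal_objective_le) auto
    also have "\<dots> \<le> real n * (real n + lam $ 0)\<^sup>2"
      using n lam0 by (intro mult_left_mono power_mono) auto
    also have "\<dots> \<le> rho_bar n lam beta" using n by (intro rho_bar_ge) auto
    finally show ?thesis unfolding r_def R_def by (intro max.coboundedI1 real_sqrt_le_mono)
  qed
  have q_le: "\<bar>q l j\<bar> \<le> r" if "l < n" "j < n" for l j
  proof -
    have "(q l j)\<^sup>2 \<le> (\<Sum>j<n. (q l j)\<^sup>2)" using that by (intro member_le_sum) auto
    also have "\<dots> \<le> (\<Sum>l<n. \<Sum>j<n. (q l j)\<^sup>2)"
      using that by (intro member_le_sum[of l _ "\<lambda>l. \<Sum>j<n. (q l j)\<^sup>2"]) (auto intro: sum_nonneg)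
    finally show ?thesis unfolding r_def obj by (simp add: real_le_rsqrt)
  qed
  have qsum: "(\<Sum>l<n. \<Sum>j<n. \<bar>q l j\<bar>) \<le> real (n\<^sup>2) * r"
  proof -
    have "(\<Sum>l<n. \<Sum>j<n. \<bar>q l j\<bar>) \<le> (\<Sum>l<n. \<Sum>j<n. r)" using q_le by (intro sum_mono) auto
    then show ?thesis by (simp add: power2_eq_square mult.assoc)
  qed
  have entry: "\<bar>P $$ (s, j)\<bar> \<le> rho n lam beta" if s: "s < n" and j: "j < n" for s j
  proof -
    \<comment> \<open>The absolute value of the coefficient with which row \<open>s\<close> survives
      the product of all factors \<open>m \<noteq> s\<close>.\<close>
    define z where "z = \<bar>beta $ s\<bar> * (\<Prod>m\<in>{..<n}-{s}. \<bar>lam $ s - lam $ m\<bar>)"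
    have "lam $ s \<noteq> lam $ m" if "m \<in> {..<n}-{s}" for m
      using inj_onD[OF inj, of s m] s that by auto
    then have zpos: "0 < z" unfolding z_def using beta0[OF s] by (intro mult_pos_pos prod_pos) auto
    have z_sq: "z\<^sup>2 = (beta $ s)\<^sup>2 * (\<Prod>m\<in>{..<n}-{s}. (lam $ s - lam $ m)\<^sup>2)"
      unfolding z_def by (simp add: power_mult_distrib prod_power_distrib)
    have "(\<Prod>m\<in>{..<n}-{s}. \<bar>lam $ s - lam $ m\<bar>) \<le> (\<Prod>m\<in>{..<n}-{s}. 2)"
    proof (intro prod_mono conjI)
      fix m assume "m \<in> {..<n}-{s}"
      then show "\<bar>lam $ s - lam $ m\<bar> \<le> 2" using lam_le1[OF s] lam_le1[of m] by auto
    qed auto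
    then have z_le: "z \<le> b * 2 ^ (n - 1)"
      unfolding z_def using beta_le[OF s] bpos s
      by (intro mult_mono) (auto intro!: prod_nonneg simp: card_Diff_singleton)
    have S_ge: "1 \<le> real (Suc k) * 2 ^ k * z\<^sup>2 * S"
      unfolding S_def z_sq by (rule gam_quotient_ge[OF beta0 inj n s refl refl])
    \<comment> \<open>A nonpositive \<open>S\<close> would contradict the lower bound 1 in
      \<open>S_ge\<close>.\<close>
    have Spos: "0 < S"
    proof (rule ccontr)
      assume "\<not> 0 < S"
      then have "real (Suc k) * 2 ^ k * z\<^sup>2 * S \<le> 0" by (intro mult_nonneg_nonpos) auto
      with S_ge show False by simp
    qed
    have "\<bar>P $$ (s, j)\<bar> * z
        = \<bar>\<Sum>l<n. beta $ l * (\<Prod>m\<in>{..<n}-{s}. lam $ l - lam $ m) * P $$ (l, j)\<bar>"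
      unfolding annihilated_row[OF s, of "\<lambda>l. beta $ l" "\<lambda>l. lam $ l" "\<lambda>l j. P $$ (l, j)" j]
      by (simp add: z_def abs_mult abs_prod mult_ac)
    also have "\<dots> \<le> (\<Sum>j<n. \<bar>\<Sum>l<n. beta $ l * (\<Prod>m\<in>{..<n}-{s}. lam $ l - lam $ m) * P $$ (l, j)\<bar>)"
      using j by (intro member_le_sum[of j _
        "\<lambda>j. \<bar>\<Sum>l<n. beta $ l * (\<Prod>m\<in>{..<n}-{s}. lam $ l - lam $ m) * P $$ (l, j)\<bar>"]) auto
    also have "\<dots> \<le> 2 ^ card ({..<n}-{s}) * (1 + card ({..<n}-{s})
        * (b * (\<Sum>l<n. \<Sum>j<n. \<bar>q l j\<bar>)) / 2)"
      using Apos Asum lam_le1 beta_le start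
      by (intro sum_abs_annihilated_le[where a = "\<lambda>i j. A $$ (i, j)"]) (auto simp: q_def)
    also have "\<dots> = 2 ^ (n - 1) * (1 + real (n - 1) * (b * (\<Sum>l<n. \<Sum>j<n. \<bar>q l j\<bar>)) / 2)"
      using s by (simp add: card_Diff_singleton)
    also have "\<dots> \<le> 2 ^ (n - 1) * (1 + real (n - 1) * (b * (real (n\<^sup>2) * r)) / 2)"
      using qsum bpos by (intro mult_left_mono add_left_mono divide_right_mono) auto
    finally have "\<bar>P $$ (s, j)\<bar> * z \<le> \<dots>" .
    then have "\<bar>P $$ (s, j)\<bar> \<le> 2 ^ (n * (n - 2)) * S ^ n * (b\<^sup>2 + 4) ^ (n\<^sup>2 - 1)
        * fact (n\<^sup>2 - 1) * (real n + lam $ 0 + b) * R"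
      using n zpos Spos bpos lam0 r0 rR z_le S_ge
      by (intro le_rho_form_of_estimates) (auto simp: R_def)
    then show ?thesis unfolding rho_def S_def b_def R_def .
  qed
  show ?thesis
    unfolding max_norm_mat_def
  proof (rule Max.boundedI)
    show "finite (abs ` elements_mat P)" by (simp add: elements_mat_def)
    have "P $$ (0, 0) \<in> elements_mat P" using P n by (intro elements_matI) auto
    then show "abs ` elements_mat P \<noteq> {}" by auto
    fix x assume "x \<in> abs ` elements_mat P"
    then show "x \<le> rho n lam beta" using P entry by auto
  qed
qed

end
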